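(* For a real number $a$, let $f_a:(0,\infty)\to\mathbb{R}$ be defined by $$f_a(x)=\frac{\bigl(a+\sqrt{1+x^2}\,\bigr)\arctan x}{x},\qquad x>0.$$ Then: (1) when $a\le -1$ or $0\le a\le \frac12$, the function $f_a$ is strictly increasing on $(0,\infty)$; (2) when $a\ge \frac{2}{\pi}$, the function $f_a$ is strictly decreasing on $(0,\infty)$; (3) when $\frac12<a<\frac{2}{\pi}$, the function $f_a$ has a unique minimum on $(0,\infty)$, i.e. there is exactly one point $x_0\in(0,\infty)$ at which $f_a$ attains its minimum over $(0,\infty)$. *)

theory Defs
  imports Complex_Main
begin

definition f_arctan :: "real \<Rightarrow> real \<Rightarrow> real" where
  "f_arctan a x = (a + sqrt (1 + x\<^sup>2)) * arctan x / x"

end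

(* Substituting x = tan t turns f_arctan a x into F t = (a cos t + 1) t / sin t, and F' has the sign of
   N t - a D t with N t = sin t - t cos t and D t = t - sin t cos t. Since N' / D' = t / (2 sin t) is
   strictly increasing on (0, pi/2], the monotone form of l'Hopital's rule makes N / D strictly
   increasing; it runs from the limit 1/2 at 0 to the value 2/pi at pi/2. *)

theory Submission
  imports Defs
begin

section \<open>The substitution x = tan t and its derivatives\<close>

definition subst_fun :: "real \<Rightarrow> real \<Rightarrow> real" where
  "subst_fun a t = (a * cos t + 1) * t / sin t"

text \<open>The difference N - a D stands in for the quotient N / D, whose denominator vanishes at
  0; its sign still compares the quotient with \<open>a\<close>.\<close>

definition deriv_num :: "real \<Rightarrow> real \<Rightarrow> real" where
  "deriv_num a t = sin t - t * cos t - a * (t - sin t * cos t)"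

lemma f_arctan_eq_subst_fun:
  assumes "x > 0"
  shows "f_arctan a x = subst_fun a (arctan x)"
proof -
  have "sqrt (1 + x\<^sup>2) > 0"
    by (simp add: add_pos_nonneg)
  then show ?thesis
    using assms by (simp add: f_arctan_def subst_fun_def cos_arctan sin_arctan field_simps)
qed

lemma subst_fun_has_derivative:
  assumes "sin t \<noteq> 0"
  shows "(subst_fun a has_real_derivative deriv_num a t / (sin t)\<^sup>2) (at t)"
proof -
  have "((\<lambda>t. (a * cos t + 1) * t / sin t) has_real_derivative
    ((a * cos t + 1 - a * sin t * t) * sin t - (a * cos t + 1) * t * cos t) / (sin t)\<^sup>2) (at t)"
    using assms by (auto intro!: derivative_eq_intros simp: power2_eq_square algebra_simps)
  moreover have "(a * cos t + 1 - a * sin t * t) * sin t - (a * cos t + 1) * t * cos t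
      = deriv_num a t"
  proof -
    have "(sin t)\<^sup>2 = 1 - (cos t)\<^sup>2"
      by (simp add: sin_squared_eq)
    then show ?thesis
      unfolding deriv_num_def by algebra
  qed
  ultimately show ?thesis
    by (simp add: subst_fun_def[abs_def])
qed

text \<open>Since 1 + sin^2 - cos^2 = 2 sin^2, a factor \<open>sin t\<close> splits off. On (0, pi)
  the sign then depends only on how \<open>t / sin t\<close> compares with
  \<open>2 * a\<close>.\<close>

lemma deriv_num_has_derivative:
  "(deriv_num a has_real_derivative sin t * (t - 2 * a * sin t)) (at t)"
proof -
  have "((\<lambda>t. sin t - t * cos t - a * (t - sin t * cos t)) has_real_derivative
    t * sin t - a * (1 + sin t * sin t - cos t * cos t)) (at t)"
    by (auto intro!: derivative_eq_intros simp: algebra_simps)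
  moreover have "t * sin t - a * (1 + sin t * sin t - cos t * cos t)
      = sin t * (t - 2 * a * sin t)"
    using sin_cos_squared_add[of t] by algebra
  ultimately show ?thesis
    by (simp add: deriv_num_def[abs_def])
qed

section \<open>Sign of \<open>deriv_num\<close> on (0, pi/2]\<close>

lemma continuous_on_deriv_num: "continuous_on S (deriv_num a)"
  by (intro continuous_at_imp_continuous_on ballI DERIV_isCont[OF deriv_num_has_derivative])

lemma deriv_num_0: "deriv_num a 0 = 0"
  by (simp add: deriv_num_def)

lemma deriv_num_pi_half: "deriv_num a (pi / 2) = 1 - a * pi / 2"
  by (simp add: deriv_num_def)

lemma deriv_num_less:
  assumes "0 \<le> u" "u < v" "v \<le> pi / 2"
    and "\<And>t. u < t \<Longrightarrow> t < v \<Longrightarrow> 2 * a * sin t < t"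
  shows "deriv_num a u < deriv_num a v"
\<comment> \<open>Only interior points are tested, so u = 0 is allowed although the derivative
  vanishes there.\<close>
proof (rule DERIV_pos_imp_increasing_open[OF assms(2)])
  fix t assume "u < t" "t < v"
  with assms have "0 < sin t * (t - 2 * a * sin t)"
    by (auto intro!: mult_pos_pos sin_gt_zero)
  then show "\<exists>y. (deriv_num a has_real_derivative y) (at t) \<and> 0 < y"
    using deriv_num_has_derivative by blast
qed (rule continuous_on_deriv_num)

lemma deriv_num_greater:
  assumes "0 \<le> u" "u < v" "v \<le> pi / 2"
    and "\<And>t. u < t \<Longrightarrow> t < v \<Longrightarrow> t < 2 * a * sin t"
  shows "deriv_num a v < deriv_num a u"
proof (rule DERIV_neg_imp_decreasing_open[OF assms(2)])
  fix t assume "u < t" "t < v"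
  with assms have "sin t * (t - 2 * a * sin t) < 0"
    by (auto intro!: mult_pos_neg sin_gt_zero)
  then show "\<exists>y. (deriv_num a has_real_derivative y) (at t) \<and> y < 0"
    using deriv_num_has_derivative by blast
qed (rule continuous_on_deriv_num)

lemma sin_less_self:
  fixes x :: real
  assumes "0 < x" "x \<le> pi"
  shows "sin x < x"
proof -
  have "0 - sin 0 < x - sin x"
  proof (rule DERIV_pos_imp_increasing_open[OF assms(1)])
    fix t assume "0 < t" "t < x"
    then have "cos t < 1"
      using cos_monotone_0_pi[of 0 t] assms by simp
    then show "\<exists>y. ((\<lambda>t. t - sin t) has_real_derivative y) (at t) \<and> 0 < y"
      by (intro exI[of _ "1 - cos t"]) (auto intro!: derivative_eq_intros)
  qed (intro continuous_intros)
  then show ?thesis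
    by simp
qed

text \<open>Here 2 a sin s \<le> sin s < s, so \<open>deriv_num a\<close> climbs strictly from its
  value 0 at 0.\<close>

lemma deriv_num_pos:
  assumes "a \<le> 1 / 2" "0 < t" "t \<le> pi / 2"
  shows "0 < deriv_num a t"
proof -
  have "2 * a * sin s < s" if "0 < s" "s < t" for s
  proof -
    have "sin s > 0"
      using that assms by (intro sin_gt_zero) auto
    then have "2 * a * sin s \<le> 1 * sin s"
      using assms by (intro mult_right_mono) auto
    also have "\<dots> < s"
      using sin_less_self[of s] that assms by simp
    finally show ?thesis .
  qed
  then show ?thesis
    using deriv_num_less[of 0 t a] assms deriv_num_0 by simp
qed

text \<open>The ratio is \<open>subst_fun 0\<close>, so its derivative has numerator
  \<open>deriv_num 0\<close>, which is positive because 0 \<le> 1/2.\<close>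

lemma div_sin_strict_mono:
  fixes u v :: real
  assumes "0 < u" "u < v" "v \<le> pi / 2"
  shows "u / sin u < v / sin v"
proof (rule DERIV_pos_imp_increasing[OF assms(2)])
  fix t assume t: "u \<le> t" "t \<le> v"
  then have s: "sin t > 0"
    using assms by (intro sin_gt_zero) auto
  moreover have "0 < deriv_num 0 t"
    using t assms by (intro deriv_num_pos) auto
  ultimately show "\<exists>y. ((\<lambda>t. t / sin t) has_real_derivative y) (at t) \<and> 0 < y"
    using subst_fun_has_derivative[of t 0]
    by (intro exI[of _ "deriv_num 0 t / (sin t)\<^sup>2"]) (simp add: subst_fun_def[abs_def])
qed

text \<open>The monotone l'Hopital rule in disguise: it says that \<open>N / D\<close> cannot drop below a value \<open>a\<close>
  once it has reached it.\<close>
lemma deriv_num_pos_of_root: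
  assumes "0 < u" "u < v" "v \<le> pi / 2" "0 \<le> deriv_num a u"
  shows "0 < deriv_num a v"
proof -
  have sin_pos: "sin t > 0" if "0 < t" "t \<le> pi / 2" for t
    using that by (intro sin_gt_zero) auto
  \<comment> \<open>Otherwise \<open>t / sin t\<close> stays below \<open>2 * a\<close> on (0, u),
    and \<open>deriv_num a\<close> falls strictly from 0 to a negative value at u.\<close>
  have "2 * a < u / sin u"
  proof (rule ccontr)
    assume *: "\<not> 2 * a < u / sin u"
    have "t < 2 * a * sin t" if "0 < t" "t < u" for t
    proof -
      have "t / sin t < 2 * a"
        using div_sin_strict_mono[of t u] * that assms by linarith
      then show ?thesis
        using sin_pos[of t] that assms by (simp add: field_simps)
    qed
    then have "deriv_num a u < 0"
      using deriv_num_greater[of 0 u a] assms deriv_num_0 by simp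
    with assms show False by simp
  qed
  \<comment> \<open>Beyond u the ratio \<open>t / sin t\<close> is larger still, so
    \<open>deriv_num a\<close> rises from u to v.\<close>
  have "2 * a * sin t < t" if "u < t" "t < v" for t
  proof -
    have "2 * a < t / sin t"
      using div_sin_strict_mono[of u t] \<open>2 * a < u / sin u\<close> that assms by linarith
    then show ?thesis
      using sin_pos[of t] that assms by (simp add: field_simps)
  qed
  then show ?thesis
    using deriv_num_less[of u v a] assms by simp
qed

text \<open>Near 0 the factor t - 2 a sin t has slope 1 - 2 a < 0, so it is negative just to the
  right of 0 and \<open>deriv_num a\<close> drops below its value 0 there.\<close>

lemma ex_deriv_num_neg:
  assumes "1 / 2 < a"
  obtains t where "0 < t" "t < pi / 2" "deriv_num a t < 0"
proof -
  have "((\<lambda>t. t - 2 * a * sin t) has_real_derivative 1 - 2 * a) (at 0)"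
    by (auto intro!: derivative_eq_intros)
  from DERIV_neg_dec_right[OF this] assms obtain d
    where d: "d > 0" "\<And>h. 0 < h \<Longrightarrow> h < d \<Longrightarrow> h < 2 * a * sin h"
    by auto
  define t where "t = min (d / 2) (pi / 4)"
  have t: "0 < t" "t < d" "t < pi / 2"
    using d(1) pi_gt_zero unfolding t_def by linarith+
  then have "deriv_num a t < 0"
    using deriv_num_greater[of 0 t a] d(2) deriv_num_0 by simp
  with t show ?thesis
    using that by blast
qed

section \<open>From the sign of \<open>deriv_num\<close> to monotonicity\<close>

lemma subst_fun_less:
  assumes "0 < u" "u < v" "v < pi" "\<And>t. u < t \<Longrightarrow> t < v \<Longrightarrow> 0 < deriv_num a t"
  shows "subst_fun a u < subst_fun a v"
\<comment> \<open>The open form lets an endpoint be a zero of \<open>deriv_num a\<close>, as happens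
  at the minimum.\<close>
proof (rule DERIV_pos_imp_increasing_open[OF assms(2)])
  have nz: "sin t \<noteq> 0" if "u \<le> t" "t \<le> v" for t
    using sin_gt_zero[of t] that assms by simp
  show "\<exists>y. (subst_fun a has_real_derivative y) (at t) \<and> 0 < y" if "u < t" "t < v" for t
    using subst_fun_has_derivative[OF nz, of t a] assms(4)[of t] nz[of t] that
    by (intro exI[of _ "deriv_num a t / (sin t)\<^sup>2"]) simp
  show "continuous_on {u..v} (subst_fun a)"
    by (intro continuous_at_imp_continuous_on ballI DERIV_isCont[OF subst_fun_has_derivative] nz)
      auto
qed

lemma subst_fun_greater:
  assumes "0 < u" "u < v" "v < pi" "\<And>t. u < t \<Longrightarrow> t < v \<Longrightarrow> deriv_num a t < 0"
  shows "subst_fun a v < subst_fun a u"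
proof (rule DERIV_neg_imp_decreasing_open[OF assms(2)])
  have nz: "sin t \<noteq> 0" if "u \<le> t" "t \<le> v" for t
    using sin_gt_zero[of t] that assms by simp
  show "\<exists>y. (subst_fun a has_real_derivative y) (at t) \<and> y < 0" if "u < t" "t < v" for t
    using subst_fun_has_derivative[OF nz, of t a] assms(4)[of t] nz[of t] that
    by (intro exI[of _ "deriv_num a t / (sin t)\<^sup>2"]) (simp add: divide_neg_pos)
  show "continuous_on {u..v} (subst_fun a)"
    by (intro continuous_at_imp_continuous_on ballI DERIV_isCont[OF subst_fun_has_derivative] nz)
      auto
qed

lemma f_arctan_less:
  assumes "0 < x" "x < y" "\<And>t. arctan x < t \<Longrightarrow> t < arctan y \<Longrightarrow> 0 < deriv_num a t"
  shows "f_arctan a x < f_arctan a y"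
proof -
  have "0 < arctan x" "arctan x < arctan y"
    using assms by (simp_all add: arctan_less_iff)
  moreover have "arctan y < pi"
    using arctan_ubound[of y] pi_gt_zero by linarith
  ultimately show ?thesis
    using subst_fun_less[of "arctan x" "arctan y" a] assms by (simp add: f_arctan_eq_subst_fun)
qed

lemma f_arctan_greater:
  assumes "0 < x" "x < y" "\<And>t. arctan x < t \<Longrightarrow> t < arctan y \<Longrightarrow> deriv_num a t < 0"
  shows "f_arctan a y < f_arctan a x"
proof -
  have "0 < arctan x" "arctan x < arctan y"
    using assms by (simp_all add: arctan_less_iff)
  moreover have "arctan y < pi"
    using arctan_ubound[of y] pi_gt_zero by linarith
  ultimately show ?thesis
    using subst_fun_greater[of "arctan x" "arctan y" a] assms by (simp add: f_arctan_eq_subst_fun)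
qed

lemma arctan_between:
  assumes "0 < x" "arctan x < t" "t < arctan y"
  shows "0 < t" "t < pi / 2"
proof -
  show "0 < t"
    using assms zero_less_arctan_iff[of x] by linarith
  show "t < pi / 2"
    using assms arctan_ubound[of y] by linarith
qed

section \<open>The three ranges of the parameter\<close>

lemma f_arctan_strict_mono:
  assumes "a \<le> 1 / 2"
  shows "strict_mono_on {0<..} (f_arctan a)"
proof (rule strict_mono_onI)
  fix x y :: real assume "x \<in> {0<..}" "y \<in> {0<..}" "x < y"
  then show "f_arctan a x < f_arctan a y"
    using deriv_num_pos[OF assms] arctan_between[of x _ y]
    by (intro f_arctan_less) (auto simp: less_imp_le)
qed

lemma f_arctan_strict_antimono:
  assumes "a \<ge> 2 / pi"
  shows "strict_antimono_on {0<..} (f_arctan a)"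
proof (rule monotone_onI)
  fix x y :: real assume xy: "x \<in> {0<..}" "y \<in> {0<..}" "x < y"
  have "deriv_num a (pi / 2) \<le> 0"
    using assms by (simp add: deriv_num_pi_half field_simps)
  \<comment> \<open>A nonnegative value at t would force a positive one at pi/2.\<close>
  then have "deriv_num a t < 0" if "0 < t" "t < pi / 2" for t
    using deriv_num_pos_of_root[of t "pi / 2" a] that by linarith
  then show "f_arctan a y < f_arctan a x"
    using xy arctan_between[of x _ y] by (intro f_arctan_greater) auto
qed

lemma f_arctan_unique_min:
  assumes "1 / 2 < a" "a < 2 / pi"
  shows "\<exists>!x0. x0 \<in> {0<..} \<and> (\<forall>x\<in>{0<..}. f_arctan a x0 \<le> f_arctan a x)"
proof -
  obtain s where s: "0 < s" "s < pi / 2" "deriv_num a s < 0"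
    using ex_deriv_num_neg[OF assms(1)] .
  have end_pos: "0 < deriv_num a (pi / 2)"
    using assms by (simp add: deriv_num_pi_half field_simps)
  \<comment> \<open>Starting at s rather than at 0 keeps the intermediate value theorem away from
    the trivial zero at 0.\<close>
  obtain t0 where t0: "s \<le> t0" "t0 \<le> pi / 2" "deriv_num a t0 = 0"
    using IVT'[of "deriv_num a" s 0 "pi / 2"] s end_pos continuous_on_deriv_num by auto
  have "t0 \<noteq> pi / 2"
    using t0(3) end_pos by force
  then have t0': "0 < t0" "t0 < pi / 2"
    using t0 s by simp_all
  have pos: "0 < deriv_num a t" if "t0 < t" "t < pi / 2" for t
    using deriv_num_pos_of_root[of t0 t a] t0 t0' that by simp
  \<comment> \<open>A nonnegative value before t0 would make \<open>deriv_num a t0\<close>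
    positive.\<close>
  have neg: "deriv_num a t < 0" if "0 < t" "t < t0" for t
    using deriv_num_pos_of_root[of t t0 a] t0 that by force
  define x0 where "x0 = tan t0"
  have x0: "0 < x0" "arctan x0 = t0"
    using t0' by (auto simp: x0_def tan_gt_zero arctan_tan)
  \<comment> \<open>Strictness away from x0 yields both minimality and uniqueness.\<close>
  have less: "f_arctan a x0 < f_arctan a x" if "0 < x" "x \<noteq> x0" for x
  proof (cases "x < x0")
    case True
    have "deriv_num a t < 0" if "arctan x < t" "t < arctan x0" for t
      using neg[of t] arctan_between[OF \<open>0 < x\<close> that] that x0 by simp
    then show ?thesis
      using f_arctan_greater[of x x0 a] True \<open>0 < x\<close> by blast
  next
    case False
    have "0 < deriv_num a t" if "arctan x0 < t" "t < arctan x" for t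
      using pos[of t] arctan_between[OF x0(1) that] that x0 by simp
    then show ?thesis
      using f_arctan_less[of x0 x a] False that x0 by force
  qed
  show ?thesis
  proof (rule ex1I[of _ x0])
    show "x0 \<in> {0<..} \<and> (\<forall>x\<in>{0<..}. f_arctan a x0 \<le> f_arctan a x)"
      using x0 less by (auto simp: less_imp_le) (metis less_imp_le order_refl)
  next
    fix y assume "y \<in> {0<..} \<and> (\<forall>x\<in>{0<..}. f_arctan a y \<le> f_arctan a x)"
    then show "y = x0"
      using x0(1) less[of y] by (metis greaterThan_iff not_le)
  qed
qed

theorem theorem1:
  fixes a :: real
  shows "(a \<le> -1 \<or> (0 \<le> a \<and> a \<le> 1 / 2) \<longrightarrow> strict_mono_on {0<..} (f_arctan a)) \<and>
    (a \<ge> 2 / pi \<longrightarrow> strict_antimono_on {0<..} (f_arctan a)) \<and>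
    (1 / 2 < a \<and> a < 2 / pi \<longrightarrow>
      (\<exists>!x0. x0 \<in> {0<..} \<and> (\<forall>x\<in>{0<..}. f_arctan a x0 \<le> f_arctan a x)))"
  using f_arctan_strict_mono[of a] f_arctan_strict_antimono[of a] f_arctan_unique_min[of a] by auto

end
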